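(* Let $G$ and $H$ be finite groups that are isoclinic via the isoclinism $(\eta, \xi)$. Suppose that $(G, N_1, M_1)$ is a Camina triple of $G$. Define subgroups $N_2$ and $M_2$ of $H$ by $\eta(N_1/Z(G)) = N_2/Z(H)$ (with $Z(H) \le N_2$) and $M_2 = \xi(M_1)$. Then $(H, N_2, M_2)$ is a Camina triple of $H$.
   Context: A triple $(G, N, M)$, where $G$ is a finite group and $N \ge M$ are nontrivial proper normal subgroups of $G$, is a Camina triple if every $g \in G \setminus N$ is conjugate in $G$ to every element of the coset $gM$. For a Camina triple $(G,N,M)$ one has $Z(G) \le N$ and $M \le G'$, so the definitions of $N_2$ and $M_2$ in the claim make sense. An isoclinism between finite groups $G$ and $H$ is a pair $(\eta,\xi)$ of isomorphisms $\eta : G/Z(G) \to H/Z(H)$ and $\xi : G' \to H'$ (where $Z(\cdot)$ is the center and $'$ denotes the commutator subgroup) compatible with commutator maps, i.e. whenever $\eta(g_i Z(G)) = h_i Z(H)$ for $i=1,2$ with $g_i \in G$, $h_i \in H$, one has $\xi([g_1,g_2]) = [h_1,h_2]$. *)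

theory Defs
  imports "HOL-Algebra.Algebra"
begin

definition center :: "('a, 'b) monoid_scheme \<Rightarrow> 'a set" where
  "center G = {z \<in> carrier G. \<forall>g \<in> carrier G. z \<otimes>\<^bsub>G\<^esub> g = g \<otimes>\<^bsub>G\<^esub> z}"

text \<open>Same commutator convention as in the library's \<open>derived_set\<close>. For isoclinisms the
  convention is immaterial: $x^{-1} y^{-1} x y$ is the commutator below of $x^{-1}$ and $y^{-1}$.\<close>

definition commutator :: "('a, 'b) monoid_scheme \<Rightarrow> 'a \<Rightarrow> 'a \<Rightarrow> 'a" where
  "commutator G x y = x \<otimes>\<^bsub>G\<^esub> y \<otimes>\<^bsub>G\<^esub> inv\<^bsub>G\<^esub> x \<otimes>\<^bsub>G\<^esub> inv\<^bsub>G\<^esub> y"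

abbreviation derived_subgroup ::
  "('a, 'b) monoid_scheme \<Rightarrow> ('a, 'b) monoid_scheme" where
  "derived_subgroup G \<equiv> G\<lparr>carrier := derived G (carrier G)\<rparr>"

definition conjugate_in :: "('a, 'b) monoid_scheme \<Rightarrow> 'a \<Rightarrow> 'a \<Rightarrow> bool" where
  "conjugate_in G x y \<longleftrightarrow> (\<exists>a \<in> carrier G. y = a \<otimes>\<^bsub>G\<^esub> x \<otimes>\<^bsub>G\<^esub> inv\<^bsub>G\<^esub> a)"

definition camina_triple ::
  "('a, 'b) monoid_scheme \<Rightarrow> 'a set \<Rightarrow> 'a set \<Rightarrow> bool" where
  "camina_triple G N M \<longleftrightarrow>
     group G \<and> finite (carrier G) \<and>
     N \<lhd> G \<and> M \<lhd> G \<and> M \<subseteq> N \<and>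
     N \<noteq> {\<one>\<^bsub>G\<^esub>} \<and> N \<noteq> carrier G \<and> M \<noteq> {\<one>\<^bsub>G\<^esub>} \<and> M \<noteq> carrier G \<and>
     (\<forall>g \<in> carrier G - N. \<forall>x \<in> g <#\<^bsub>G\<^esub> M. conjugate_in G g x)"

definition isoclinism ::
  "('a, 'c) monoid_scheme \<Rightarrow> ('b, 'd) monoid_scheme \<Rightarrow> ('a set \<Rightarrow> 'b set) \<Rightarrow> ('a \<Rightarrow> 'b) \<Rightarrow> bool" where
  "isoclinism G H \<eta> \<xi> \<longleftrightarrow>
     \<eta> \<in> iso (G Mod center G) (H Mod center H) \<and>
     \<xi> \<in> iso (derived_subgroup G) (derived_subgroup H) \<and>
     (\<forall>g\<^sub>1 \<in> carrier G. \<forall>g\<^sub>2 \<in> carrier G. \<forall>h\<^sub>1 \<in> carrier H. \<forall>h\<^sub>2 \<in> carrier H.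
        \<eta> (center G #>\<^bsub>G\<^esub> g\<^sub>1) = center H #>\<^bsub>H\<^esub> h\<^sub>1 \<longrightarrow>
        \<eta> (center G #>\<^bsub>G\<^esub> g\<^sub>2) = center H #>\<^bsub>H\<^esub> h\<^sub>2 \<longrightarrow>
        \<xi> (commutator G g\<^sub>1 g\<^sub>2) = commutator H h\<^sub>1 h\<^sub>2)"

end

theory Submission
  imports Defs
begin

text \<open>Call \<open>g\<close> and \<open>h\<close> corresponding if \<open>\<eta>\<close> maps the coset of \<open>g\<close> to the coset of \<open>h\<close>. This relation is
  compatible with products and inverses, and since \<open>\<xi>\<close> and the map induced by \<open>\<eta>\<close> agree on
  commutators, \<open>d\<close> corresponds to \<open>\<xi> d\<close> for every \<open>d\<close> in the derived subgroup. The Camina condition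
  is a statement on commutators: \<open>g m = a g a\<inverse>\<close> says \<open>m = [g\<inverse>, a]\<close>, and applying \<open>\<xi>\<close> gives
  \<open>\<xi> m = [h\<inverse>, b]\<close> for corresponding elements \<open>h\<close>, \<open>b\<close>. Likewise
  \<open>h \<xi>(m) h\<inverse> = [h, \<xi> m] \<xi>(m) = \<xi>(g m g\<inverse>)\<close> makes the image of \<open>M\<close> normal.\<close>

section \<open>Centre, commutators and central cosets in a single group\<close>

context group
begin

lemma center_normal: "center G \<lhd> G"
proof (rule normal_invI)
  show "subgroup (center G) G"
  proof (rule subgroupI)
    show "center G \<subseteq> carrier G" "center G \<noteq> {}"
      by (auto simp: center_def)
  next
    fix a assume "a \<in> center G"
    then have a: "a \<in> carrier G" "\<And>g. g \<in> carrier G \<Longrightarrow> a \<otimes> g = g \<otimes> a"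
      by (auto simp: center_def)
    have "inv a \<otimes> g = g \<otimes> inv a" if "g \<in> carrier G" for g
      using a that by (metis inv_closed inv_solve_left inv_solve_right m_assoc m_closed)
    with a(1) show "inv a \<in> center G"
      by (simp add: center_def)
  next
    fix a b assume "a \<in> center G" "b \<in> center G"
    then have a: "a \<in> carrier G" "\<And>g. g \<in> carrier G \<Longrightarrow> a \<otimes> g = g \<otimes> a"
      and b: "b \<in> carrier G" "\<And>g. g \<in> carrier G \<Longrightarrow> b \<otimes> g = g \<otimes> b"
      by (auto simp: center_def)
    have "a \<otimes> b \<otimes> g = g \<otimes> (a \<otimes> b)" if "g \<in> carrier G" for g
      using a b that by (metis m_assoc)
    with a(1) b(1) show "a \<otimes> b \<in> center G"
      by (simp add: center_def)
  qed
next
  fix x h assume "x \<in> carrier G" "h \<in> center G"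
  then have "x \<otimes> h = h \<otimes> x" "h \<in> carrier G"
    by (simp_all add: center_def)
  with \<open>x \<in> carrier G\<close> have "x \<otimes> h \<otimes> inv x = h"
    by (simp add: m_assoc)
  with \<open>h \<in> center G\<close> show "x \<otimes> h \<otimes> inv x \<in> center G"
    by simp
qed

lemma commutator_closed:
  "x \<in> carrier G \<Longrightarrow> y \<in> carrier G \<Longrightarrow> commutator G x y \<in> carrier G"
  by (simp add: commutator_def)

lemma commutator_in_derived:
  "x \<in> carrier G \<Longrightarrow> y \<in> carrier G \<Longrightarrow> commutator G x y \<in> derived G (carrier G)"
  unfolding derived_def commutator_def by (rule generate.incl) blast

lemma inv_commutator:
  "x \<in> carrier G \<Longrightarrow> y \<in> carrier G \<Longrightarrow> inv (commutator G x y) = commutator G y x"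
  by (simp add: commutator_def inv_mult_group m_assoc)

text \<open>Splits a conjugate into two factors that both lie in the derived subgroup as soon as
  \<open>y\<close> does, so that a homomorphism defined only there can be evaluated on it.\<close>

lemma commutator_mult_eq_conjugate:
  assumes "x \<in> carrier G" "y \<in> carrier G"
  shows "commutator G x y \<otimes> y = x \<otimes> y \<otimes> inv x"
  using assms by (simp add: commutator_def m_assoc)

lemma conjugate_eq_mult_commutator:
  assumes "x \<in> carrier G" "a \<in> carrier G"
  shows "a \<otimes> x \<otimes> inv a = x \<otimes> commutator G (inv x) a"
  using assms by (simp add: commutator_def m_assoc[symmetric])

lemma derived_group: "group (derived_subgroup G)"
  by (rule subgroup_imp_group[OF derived_is_subgroup]) simp

text \<open>Passes from sets of cosets to elements. Since \<open>Z \<subseteq> K\<close>, changing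
  the representative of a coset by an element of \<open>Z\<close> does not lead out of
  \<open>K\<close>.\<close>

lemma rcoset_mem_subgroup_iff:
  assumes "subgroup K G" "subgroup Z G" "Z \<subseteq> K" "x \<in> carrier G"
  shows "Z #> x \<in> carrier (G\<lparr>carrier := K\<rparr> Mod Z) \<longleftrightarrow> x \<in> K"
proof
  assume "x \<in> K"
  then show "Z #> x \<in> carrier (G\<lparr>carrier := K\<rparr> Mod Z)"
    by (auto simp: FactGroup_def RCOSETS_def r_coset_def)
next
  assume "Z #> x \<in> carrier (G\<lparr>carrier := K\<rparr> Mod Z)"
  then obtain k where k: "k \<in> K" "Z #> x = Z #> k"
    by (auto simp: FactGroup_def RCOSETS_def r_coset_def)
  have "x \<in> Z #> k"
    using k(2) rcos_self[OF assms(4,2)] by simp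
  then obtain z where "z \<in> Z" "x = z \<otimes> k"
    by (auto simp: r_coset_def)
  with k(1) assms(1,3) show "x \<in> K"
    by (auto intro: subgroup.m_closed)
qed

end

section \<open>Consequences of the Camina condition\<close>

lemma camina_triple_center_subset:
  assumes "camina_triple G N M"
  shows "center G \<subseteq> N"
proof
  interpret group G using assms by (simp add: camina_triple_def)
  have M: "subgroup M G" "M \<noteq> {\<one>\<^bsub>G\<^esub>}"
    using assms by (auto simp: camina_triple_def normal_imp_subgroup)
  fix z assume "z \<in> center G"
  then have z: "z \<in> carrier G" "\<And>g. g \<in> carrier G \<Longrightarrow> z \<otimes>\<^bsub>G\<^esub> g = g \<otimes>\<^bsub>G\<^esub> z"
    by (auto simp: center_def)
  show "z \<in> N"
  proof (rule ccontr)
    \<comment> \<open>A central element is conjugate only to itself, so the Camina condition would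
      shrink the coset of \<open>z\<close> to one element and force \<open>M\<close> to be
      trivial.\<close>
    assume "z \<notin> N"
    have "m = \<one>\<^bsub>G\<^esub>" if m: "m \<in> M" for m
    proof -
      have mG: "m \<in> carrier G" using M(1) m by (rule subgroup.mem_carrier)
      have "z \<otimes>\<^bsub>G\<^esub> m \<in> z <#\<^bsub>G\<^esub> M"
        using m by (auto simp: l_coset_def)
      then obtain a where a: "a \<in> carrier G" "z \<otimes>\<^bsub>G\<^esub> m = a \<otimes>\<^bsub>G\<^esub> z \<otimes>\<^bsub>G\<^esub> inv\<^bsub>G\<^esub> a"
        using assms z(1) \<open>z \<notin> N\<close> unfolding camina_triple_def conjugate_in_def by blast
      have "z \<otimes>\<^bsub>G\<^esub> m = z \<otimes>\<^bsub>G\<^esub> \<one>\<^bsub>G\<^esub>"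
        using a z by (metis inv_closed m_assoc r_inv)
      then show ?thesis using z(1) mG by simp
    qed
    with M subgroup.one_closed[OF M(1)] show False by blast
  qed
qed

lemma camina_triple_mem_eq_commutator:
  assumes "camina_triple G N M" "g \<in> carrier G" "g \<notin> N" "m \<in> M"
  obtains a where "a \<in> carrier G" "m = commutator G (inv\<^bsub>G\<^esub> g) a"
proof -
  interpret group G using assms by (simp add: camina_triple_def)
  have m: "m \<in> carrier G"
    using assms unfolding camina_triple_def by (meson normal_imp_subgroup subgroup.mem_carrier)
  have "g \<otimes>\<^bsub>G\<^esub> m \<in> g <#\<^bsub>G\<^esub> M"
    using assms(4) by (auto simp: l_coset_def)
  then obtain a where a: "a \<in> carrier G" "g \<otimes>\<^bsub>G\<^esub> m = a \<otimes>\<^bsub>G\<^esub> g \<otimes>\<^bsub>G\<^esub> inv\<^bsub>G\<^esub> a"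
    using assms unfolding camina_triple_def conjugate_in_def by blast
  then have "g \<otimes>\<^bsub>G\<^esub> m = g \<otimes>\<^bsub>G\<^esub> commutator G (inv\<^bsub>G\<^esub> g) a"
    using assms(2) conjugate_eq_mult_commutator by simp
  with a(1) m assms(2) that show thesis
    by (simp add: commutator_closed)
qed

text \<open>As \<open>N\<close> is proper, some \<open>g\<close> lies outside it, and this single
  \<open>g\<close> exhibits every element of \<open>M\<close> as a commutator with
  \<open>inv g\<close>.\<close>

lemma camina_triple_subset_derived:
  assumes "camina_triple G N M"
  shows "M \<subseteq> derived G (carrier G)"
proof
  interpret group G using assms by (simp add: camina_triple_def)
  obtain g where g: "g \<in> carrier G" "g \<notin> N"
    using assms unfolding camina_triple_def by (meson normal_imp_subgroup subgroup.subset subsetI subset_antisym)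
  fix m assume "m \<in> M"
  then show "m \<in> derived G (carrier G)"
    using camina_triple_mem_eq_commutator[OF assms g] commutator_in_derived g(1)
    by (metis inv_closed)
qed

section \<open>Corresponding elements of isoclinic groups\<close>

locale isoclinic_groups = G: group G + H: group H
  for G :: "('a, 'c) monoid_scheme" (structure) and H :: "('b, 'd) monoid_scheme" (structure) +
  fixes \<eta> :: "'a set \<Rightarrow> 'b set" and \<xi> :: "'a \<Rightarrow> 'b"
  assumes isoclinism: "isoclinism G H \<eta> \<xi>"
begin

text \<open>A relation rather than a map, because \<eta> determines the partner of an element only
  up to a central factor and no representatives have to be chosen.\<close>

definition corr :: "'a \<Rightarrow> 'b \<Rightarrow> bool" where
  "corr g h \<longleftrightarrow> g \<in> carrier G \<and> h \<in> carrier H \<and>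
     \<eta> (center G #>\<^bsub>G\<^esub> g) = center H #>\<^bsub>H\<^esub> h"

lemma eta_bij: "bij_betw \<eta> (carrier (G Mod center G)) (carrier (H Mod center H))"
  and eta_hom: "\<eta> \<in> hom (G Mod center G) (H Mod center H)"
  and xi_bij: "bij_betw \<xi> (derived G (carrier G)) (derived H (carrier H))"
  and xi_hom: "\<xi> \<in> hom (derived_subgroup G) (derived_subgroup H)"
  using isoclinism by (auto simp: isoclinism_def iso_def)

lemma xi_commutator:
  "corr g h \<Longrightarrow> corr g' h' \<Longrightarrow> \<xi> (commutator G g g') = commutator H h h'"
  using isoclinism by (auto simp: isoclinism_def corr_def)

lemma corr_carrier: "corr g h \<Longrightarrow> g \<in> carrier G" "corr g h \<Longrightarrow> h \<in> carrier H"
  by (auto simp: corr_def)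

lemma ex_corr_right:
  assumes "g \<in> carrier G"
  obtains h where "corr g h"
proof -
  have "center G #>\<^bsub>G\<^esub> g \<in> carrier (G Mod center G)"
    using assms by (auto simp: FactGroup_def RCOSETS_def)
  then have "\<eta> (center G #>\<^bsub>G\<^esub> g) \<in> carrier (H Mod center H)"
    by (rule bij_betw_apply[OF eta_bij])
  with assms that show thesis
    by (auto simp: FactGroup_def RCOSETS_def corr_def)
qed

lemma ex_corr_left:
  assumes "h \<in> carrier H"
  obtains g where "corr g h"
proof -
  have "center H #>\<^bsub>H\<^esub> h \<in> carrier (H Mod center H)"
    using assms by (auto simp: FactGroup_def RCOSETS_def)
  then obtain C where "C \<in> carrier (G Mod center G)" "\<eta> C = center H #>\<^bsub>H\<^esub> h"
    using eta_bij by (metis bij_betw_imp_surj_on imageE)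
  with assms that show thesis
    by (auto simp: FactGroup_def RCOSETS_def corr_def)
qed

lemma corr_mult:
  assumes "corr g h" "corr g' h'"
  shows "corr (g \<otimes>\<^bsub>G\<^esub> g') (h \<otimes>\<^bsub>H\<^esub> h')"
proof -
  interpret ZG: normal "center G" G by (rule G.center_normal)
  interpret ZH: normal "center H" H by (rule H.center_normal)
  have "center G #>\<^bsub>G\<^esub> g \<in> carrier (G Mod center G)" "center G #>\<^bsub>G\<^esub> g' \<in> carrier (G Mod center G)"
    using assms by (auto simp: FactGroup_def RCOSETS_def corr_def)
  from hom_mult[OF eta_hom this] show ?thesis
    using assms by (simp add: corr_def FactGroup_def ZG.rcos_sum ZH.rcos_sum)
qed

lemma corr_inv:
  assumes "corr g h"
  shows "corr (inv\<^bsub>G\<^esub> g) (inv\<^bsub>H\<^esub> h)"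
proof -
  interpret ZG: normal "center G" G by (rule G.center_normal)
  interpret ZH: normal "center H" H by (rule H.center_normal)
  interpret \<eta>: group_hom "G Mod center G" "H Mod center H" \<eta>
    by (simp add: group_hom_def group_hom_axioms_def eta_hom
        ZG.factorgroup_is_group ZH.factorgroup_is_group)
  have X: "center G #>\<^bsub>G\<^esub> g \<in> carrier (G Mod center G)"
    and Y: "center H #>\<^bsub>H\<^esub> h \<in> carrier (H Mod center H)"
    using assms by (auto simp: FactGroup_def RCOSETS_def corr_def)
  from \<eta>.hom_inv[OF X] show ?thesis
    using assms X Y by (simp add: corr_def ZG.inv_FactGroup ZH.inv_FactGroup ZG.rcos_inv ZH.rcos_inv)
qed

lemma corr_commutator:
  "corr g h \<Longrightarrow> corr g' h' \<Longrightarrow> corr (commutator G g g') (commutator H h h')"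
  unfolding commutator_def by (intro corr_mult corr_inv)

lemma corr_xi:
  assumes "d \<in> derived G (carrier G)"
  shows "corr d (\<xi> d)"
proof -
  have comm: "corr (commutator G x y) (\<xi> (commutator G x y))"
    if "x \<in> carrier G" "y \<in> carrier G" for x y
    by (metis corr_commutator ex_corr_right that xi_commutator)
  show ?thesis
    using assms unfolding derived_def
  proof (induction rule: generate.induct)
    case one
    \<comment> \<open>The identity is the commutator of the identity with itself.\<close>
    show ?case
      using comm[of "\<one>\<^bsub>G\<^esub>" "\<one>\<^bsub>G\<^esub>"] by (simp add: commutator_def)
  next
    case (incl c)
    then show ?case
      using comm by (auto simp: commutator_def)
  next
    case (inv c)
    then obtain x y where xy: "x \<in> carrier G" "y \<in> carrier G" "c = commutator G x y"
      by (auto simp: commutator_def)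
    \<comment> \<open>The inverse of [x, y] is [y, x], which is again a commutator.\<close>
    then show ?case
      using comm[of y x] by (simp add: G.inv_commutator)
  next
    case (eng c d)
    then have "\<xi> (c \<otimes>\<^bsub>G\<^esub> d) = \<xi> c \<otimes>\<^bsub>H\<^esub> \<xi> d"
      using hom_mult[OF xi_hom] by (simp add: derived_def)
    with eng.IH show ?case
      by (simp add: corr_mult)
  qed
qed

text \<open>Here \<open>g\<close> may lie outside the derived subgroup, so \<xi> cannot be applied
  factor by factor. Instead the conjugate is split as [g, d] d, and [g, d] is sent to [h, \<xi> d]
  because \<open>d\<close> corresponds to \<open>\<xi> d\<close>.\<close>

lemma xi_conjugate:
  assumes "corr g h" "d \<in> derived G (carrier G)"
  shows "\<xi> (g \<otimes>\<^bsub>G\<^esub> d \<otimes>\<^bsub>G\<^esub> inv\<^bsub>G\<^esub> g) = h \<otimes>\<^bsub>H\<^esub> \<xi> d \<otimes>\<^bsub>H\<^esub> inv\<^bsub>H\<^esub> h"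
proof -
  note c = corr_xi[OF assms(2)]
  note carr = corr_carrier[OF assms(1)] corr_carrier[OF c]
  have "\<xi> (commutator G g d \<otimes>\<^bsub>G\<^esub> d) = \<xi> (commutator G g d) \<otimes>\<^bsub>H\<^esub> \<xi> d"
    using hom_mult[OF xi_hom] assms(2) G.commutator_in_derived carr by simp
  then show ?thesis
    using carr xi_commutator[OF assms(1) c]
    by (simp add: G.commutator_mult_eq_conjugate H.commutator_mult_eq_conjugate)
qed

lemma xi_image_normal:
  assumes "M \<lhd> G" "M \<subseteq> derived G (carrier G)"
  shows "\<xi> ` M \<lhd> H"
proof (rule H.normal_invI)
  \<comment> \<open>\<xi> is a homomorphism between derived subgroups only, so the image is first a
    subgroup of the derived subgroup of \<open>H\<close>, and then of \<open>H\<close>.\<close>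
  interpret \<xi>: group_hom "derived_subgroup G" "derived_subgroup H" \<xi>
    by (simp add: group_hom_def group_hom_axioms_def xi_hom G.derived_group H.derived_group)
  have "subgroup M (derived_subgroup G)"
    using assms G.derived_is_subgroup[of "carrier G"]
    by (simp add: G.subgroup_incl normal_imp_subgroup)
  then have "subgroup (\<xi> ` M) (derived_subgroup H)"
    by (rule \<xi>.subgroup_img_is_subgroup)
  then show "subgroup (\<xi> ` M) H"
    using H.incl_subgroup H.derived_is_subgroup by blast
next
  fix h x assume h: "h \<in> carrier H" and "x \<in> \<xi> ` M"
  then obtain m where m: "m \<in> M" "x = \<xi> m" by blast
  \<comment> \<open>Surjectivity of \<eta> lets conjugation by any \<open>h\<close> be imitated by a
    conjugation in \<open>G\<close>.\<close>
  obtain g where g: "corr g h" using ex_corr_left[OF h] .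
  have "g \<otimes>\<^bsub>G\<^esub> m \<otimes>\<^bsub>G\<^esub> inv\<^bsub>G\<^esub> g \<in> M"
    using normal.inv_op_closed2[OF assms(1) corr_carrier(1)[OF g] m(1)] .
  then show "h \<otimes>\<^bsub>H\<^esub> x \<otimes>\<^bsub>H\<^esub> inv\<^bsub>H\<^esub> h \<in> \<xi> ` M"
    using xi_conjugate[OF g, of m] m assms(2) by (metis imageI subsetD)
qed

text \<open>Makes the equation that defines the second subgroup usable for elements. The direction
  from \<open>L\<close> back to \<open>K\<close> rests on the injectivity of \<eta> on all central
  cosets.\<close>

lemma corr_mem_iff:
  assumes "subgroup K G" "center G \<subseteq> K" "subgroup L H" "center H \<subseteq> L"
    and img: "\<eta> ` carrier (G\<lparr>carrier := K\<rparr> Mod center G) = carrier (H\<lparr>carrier := L\<rparr> Mod center H)"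
    and "corr g h"
  shows "g \<in> K \<longleftrightarrow> h \<in> L"
proof -
  note sub = normal_imp_subgroup[OF G.center_normal] normal_imp_subgroup[OF H.center_normal]
  have "carrier (G\<lparr>carrier := K\<rparr> Mod center G) \<subseteq> carrier (G Mod center G)"
    using subgroup.subset[OF assms(1)] by (auto simp: FactGroup_def RCOSETS_def r_coset_def)
  moreover have "center G #>\<^bsub>G\<^esub> g \<in> carrier (G Mod center G)"
    using corr_carrier[OF assms(6)] by (auto simp: FactGroup_def RCOSETS_def)
  ultimately have "center G #>\<^bsub>G\<^esub> g \<in> carrier (G\<lparr>carrier := K\<rparr> Mod center G) \<longleftrightarrow>
      center H #>\<^bsub>H\<^esub> h \<in> carrier (H\<lparr>carrier := L\<rparr> Mod center H)"
    using inj_on_image_mem_iff[OF bij_betw_imp_inj_on[OF eta_bij]] assms(6)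
    by (metis corr_def img)
  then show ?thesis
    using G.rcoset_mem_subgroup_iff[OF assms(1) sub(1) assms(2)]
      H.rcoset_mem_subgroup_iff[OF assms(3) sub(2) assms(4)] corr_carrier[OF assms(6)]
    by blast
qed

end

theorem theorem4p6:
  fixes G :: "('a, 'c) monoid_scheme" and H :: "('b, 'd) monoid_scheme"
    and \<eta> :: "'a set \<Rightarrow> 'b set" and \<xi> :: "'a \<Rightarrow> 'b"
    and N\<^sub>1 M\<^sub>1 :: "'a set" and N\<^sub>2 M\<^sub>2 :: "'b set"
  assumes "group G" and "finite (carrier G)"
    and "group H" and "finite (carrier H)"
    and "isoclinism G H \<eta> \<xi>"
    and "camina_triple G N\<^sub>1 M\<^sub>1"
    and "subgroup N\<^sub>2 H" and "center H \<subseteq> N\<^sub>2"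
    and "\<eta> ` carrier (G\<lparr>carrier := N\<^sub>1\<rparr> Mod center G) = carrier (H\<lparr>carrier := N\<^sub>2\<rparr> Mod center H)"
    and "M\<^sub>2 = \<xi> ` M\<^sub>1"
  shows "camina_triple H N\<^sub>2 M\<^sub>2"
proof -
  interpret isoclinic_groups G H \<eta> \<xi>
    using assms(1,3,5) by (simp add: isoclinic_groups_def isoclinic_groups_axioms_def)
  have N\<^sub>1: "N\<^sub>1 \<lhd> G" "N\<^sub>1 \<noteq> carrier G" and M\<^sub>1: "M\<^sub>1 \<lhd> G" "M\<^sub>1 \<noteq> {\<one>\<^bsub>G\<^esub>}" "M\<^sub>1 \<subseteq> N\<^sub>1"
    using assms(6) by (auto simp: camina_triple_def)
  note M\<^sub>1_derived = camina_triple_subset_derived[OF assms(6)]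
  note mem_iff = corr_mem_iff[OF normal_imp_subgroup[OF N\<^sub>1(1)]
      camina_triple_center_subset[OF assms(6)] assms(7,8,9)]
  have M\<^sub>2_normal: "M\<^sub>2 \<lhd> H"
    using xi_image_normal[OF M\<^sub>1(1) M\<^sub>1_derived] assms(10) by simp
  \<comment> \<open>Each \<open>m\<close> in \<open>M\<^sub>1\<close> lies in
    \<open>N\<^sub>1\<close> and corresponds to \<open>\<xi> m\<close>.\<close>
  have M\<^sub>2_sub: "M\<^sub>2 \<subseteq> N\<^sub>2"
    using mem_iff corr_xi M\<^sub>1(3) M\<^sub>1_derived assms(10) by blast
  have N\<^sub>2_normal: "N\<^sub>2 \<lhd> H"
  proof (rule H.normal_invI[OF assms(7)])
    fix h n assume h: "h \<in> carrier H" and n: "n \<in> N\<^sub>2"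
    obtain g where g: "corr g h" using ex_corr_left[OF h] .
    obtain k where k: "corr k n" using ex_corr_left[OF subgroup.mem_carrier[OF assms(7) n]] .
    have "g \<otimes>\<^bsub>G\<^esub> k \<otimes>\<^bsub>G\<^esub> inv\<^bsub>G\<^esub> g \<in> N\<^sub>1"
      using N\<^sub>1(1) mem_iff[OF k] n corr_carrier(1)[OF g] by (simp add: normal.inv_op_closed2)
    then show "h \<otimes>\<^bsub>H\<^esub> n \<otimes>\<^bsub>H\<^esub> inv\<^bsub>H\<^esub> h \<in> N\<^sub>2"
      using mem_iff[OF corr_mult[OF corr_mult[OF g k] corr_inv[OF g]]] by simp
  qed
  have N\<^sub>2_proper: "N\<^sub>2 \<noteq> carrier H"
  proof
    assume "N\<^sub>2 = carrier H"
    \<comment> \<open>Every element of \<open>G\<close> has a partner, which would lie in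
      \<open>N\<^sub>2\<close>.\<close>
    then have "carrier G \<subseteq> N\<^sub>1"
      using mem_iff by (metis corr_carrier(2) ex_corr_right subsetI)
    with N\<^sub>1 show False
      by (metis normal_imp_subgroup subgroup.subset subset_antisym)
  qed
  have M\<^sub>2_nontriv: "M\<^sub>2 \<noteq> {\<one>\<^bsub>H\<^esub>}"
  proof
    assume "M\<^sub>2 = {\<one>\<^bsub>H\<^esub>}"
    then have "\<xi> m = \<xi> \<one>\<^bsub>G\<^esub>" if "m \<in> M\<^sub>1" for m
      using that assms(10) subgroup.one_closed[OF normal_imp_subgroup[OF M\<^sub>1(1)]]
      by (metis imageI singletonD)
    \<comment> \<open>\<xi> is injective on the derived subgroup, which contains
      \<open>M\<^sub>1\<close>.\<close>
    then have "m = \<one>\<^bsub>G\<^esub>" if "m \<in> M\<^sub>1" for m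
      using that M\<^sub>1_derived subgroup.one_closed[OF G.derived_is_subgroup[OF subset_refl]]
      by (intro inj_onD[OF bij_betw_imp_inj_on[OF xi_bij]]) auto
    with M\<^sub>1 subgroup.one_closed[OF normal_imp_subgroup[OF M\<^sub>1(1)]] show False by blast
  qed
  have conj: "conjugate_in H h x" if h: "h \<in> carrier H - N\<^sub>2" and x: "x \<in> h <#\<^bsub>H\<^esub> M\<^sub>2" for h x
  proof -
    obtain m where m: "m \<in> M\<^sub>1" "x = h \<otimes>\<^bsub>H\<^esub> \<xi> m"
      using x assms(10) by (auto simp: l_coset_def)
    obtain g where g: "corr g h" using h ex_corr_left by blast
    \<comment> \<open>The partner \<open>g\<close> is outside \<open>N\<^sub>1\<close> because
      \<open>h\<close> is outside \<open>N\<^sub>2\<close>, so the Camina condition in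
      \<open>G\<close> supplies \<open>a\<close>; a partner \<open>b\<close> of \<open>a\<close>
      will be the conjugating element in \<open>H\<close>.\<close>
    obtain a where a: "a \<in> carrier G" "m = commutator G (inv\<^bsub>G\<^esub> g) a"
      using camina_triple_mem_eq_commutator[OF assms(6) corr_carrier(1)[OF g] _ m(1)]
        mem_iff[OF g] h by blast
    obtain b where b: "corr a b" using ex_corr_right[OF a(1)] .
    have "x = b \<otimes>\<^bsub>H\<^esub> h \<otimes>\<^bsub>H\<^esub> inv\<^bsub>H\<^esub> b"
      using xi_commutator[OF corr_inv[OF g] b] a(2) m(2) corr_carrier(2)[OF g] corr_carrier(2)[OF b]
      by (simp add: H.conjugate_eq_mult_commutator)
    then show ?thesis
      using corr_carrier(2)[OF b] by (auto simp: conjugate_in_def)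
  qed
  \<comment> \<open>Both follow from \<open>M\<^sub>2 \<subseteq> N\<^sub>2\<close>: a trivial
    \<open>N\<^sub>2\<close> would make \<open>M\<^sub>2\<close> trivial, and
    \<open>M\<^sub>2\<close> being all of \<open>H\<close> would do the same to
    \<open>N\<^sub>2\<close>.\<close>
  have "N\<^sub>2 \<noteq> {\<one>\<^bsub>H\<^esub>}" "M\<^sub>2 \<noteq> carrier H"
    using M\<^sub>2_nontriv M\<^sub>2_sub N\<^sub>2_proper subgroup.one_closed[OF normal_imp_subgroup[OF M\<^sub>2_normal]]
      subgroup.subset[OF assms(7)] by blast+
  then show ?thesis
    unfolding camina_triple_def
    using assms(3,4) N\<^sub>2_normal M\<^sub>2_normal M\<^sub>2_sub N\<^sub>2_proper M\<^sub>2_nontriv conj by blast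
qed

end
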